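(* Let $X=(X_t)_{t\in[0,T]}$ be a square-integrable process with energy space $\mathcal{H}_X$ and bounded stochastic integral $\delta_X\colon\mathcal{H}_X\to L^2(\Omega)$ such that (i) $\mathbb{E}[\delta_X(u)]=0$ for all $u\in\mathcal{H}_X$, and (ii) $\mathbb{E}[|\delta_X(u)|^2]=\|u\|_{\mathcal{H}_X}^2$ for all predictable $u\in\mathcal{H}_X$. Let $\mathcal{S}_X$ be the closure in $L^2(\Omega)$ of $\{\delta_X(u): u\in\mathcal{H}_X \text{ predictable}\}$. Then for every $F\in L^2(\Omega)$, $$\delta_X(\Pi_X D_X F)=\mathrm{proj}_{\mathcal{S}_X}(F-\mathbb{E}[F]),$$ where $\mathrm{proj}_{\mathcal{S}_X}$ denotes the orthogonal projection onto $\mathcal{S}_X$ in $L^2(\Omega)$.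
   Context: $(\Omega,\mathcal{F},P)$ is a complete probability space with a filtration $(\mathcal{F}_t)_{t\in[0,T]}$ satisfying the usual conditions; $L^2(\Omega)$ is the real Hilbert space of square-integrable random variables. "Predictable" means measurable with respect to the predictable $\sigma$-algebra on $[0,T]\times\Omega$ of this filtration. An energy space for a square-integrable process $X$ is a real separable Hilbert space $\mathcal{H}_X$ of (equivalence classes of) processes $u=(u_t)_{t\in[0,T]}$, together with a continuous linear operator $\delta_X\colon\mathcal{H}_X\to L^2(\Omega)$, called the stochastic integral with respect to $X$. It is assumed that $\mathcal{H}_X$ consists of jointly measurable processes and that the predictable processes form a closed linear subspace of $\mathcal{H}_X$. The predictable projection $\Pi_X\colon\mathcal{H}_X\to\mathcal{H}_X$ is the orthogonal projection onto this subspace. The operator--covariant derivative $D_X\colon L^2(\Omega)\to\mathcal{H}_X$ is the Hilbert space adjoint of $\delta_X$: for $F\in L^2(\Omega)$, $D_XF\in\mathcal{H}_X$ is the unique element with $\mathbb{E}[F\,\delta_X(u)]=\langle D_XF,u\rangle_{\mathcal{H}_X}$ for all $u\in\mathcal{H}_X$. *)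

theory Defs
  imports "HOL-Probability.Probability"
begin

section \<open>Square-integrable random variables\<close>

text \<open>
  The Hilbert space of square-integrable random variables depends on the measure and is therefore
  not a type.  Its elements are represented by functions, equality in it is equality
  almost everywhere, and closure is taken in the mean-square seminorm.
\<close>

definition L2 :: "'w measure \<Rightarrow> ('w \<Rightarrow> real) set" where
  "L2 M = {f. f \<in> borel_measurable M \<and> integrable M (\<lambda>w. (f w)\<^sup>2)}"

definition L2_inner :: "'w measure \<Rightarrow> ('w \<Rightarrow> real) \<Rightarrow> ('w \<Rightarrow> real) \<Rightarrow> real" where
  "L2_inner M f g = (LINT w|M. f w * g w)"

definition L2_norm :: "'w measure \<Rightarrow> ('w \<Rightarrow> real) \<Rightarrow> real" where
  "L2_norm M f = sqrt (L2_inner M f f)"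

definition L2_closure :: "'w measure \<Rightarrow> ('w \<Rightarrow> real) set \<Rightarrow> ('w \<Rightarrow> real) set" where
  "L2_closure M S = {f \<in> L2 M. \<forall>e>0. \<exists>g\<in>S. L2_norm M (\<lambda>w. f w - g w) < e}"

text \<open>
  The projection is determined only up to equality almost everywhere; \<open>SOME\<close> picks a version.
\<close>

definition L2_proj :: "'w measure \<Rightarrow> ('w \<Rightarrow> real) set \<Rightarrow> ('w \<Rightarrow> real) \<Rightarrow> ('w \<Rightarrow> real)" where
  "L2_proj M S f = (SOME g. g \<in> S \<and> (\<forall>h\<in>S. L2_inner M (\<lambda>w. f w - g w) h = 0))"

definition orth_proj :: "'h::real_inner set \<Rightarrow> 'h \<Rightarrow> 'h" where
  "orth_proj S x = (THE y. y \<in> S \<and> (\<forall>z\<in>S. orthogonal (x - y) z))"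


section \<open>Filtrations and predictability on a bounded time interval\<close>

text \<open>Only the values \<open>Ft t\<close> with \<open>t \<in> {0..T}\<close> matter.\<close>

locale usual_filtered_prob_space = prob_space M + complete_measure M
  for M :: "'w measure" +
  fixes T :: real and Ft :: "real \<Rightarrow> 'w measure"
  assumes T_nonneg: "0 \<le> T"
    and filtration_sub: "\<And>t. t \<in> {0..T} \<Longrightarrow> subalgebra M (Ft t)"
    and filtration_mono: "\<And>s t. 0 \<le> s \<Longrightarrow> s \<le> t \<Longrightarrow> t \<le> T \<Longrightarrow> sets (Ft s) \<subseteq> sets (Ft t)"
    and filtration_null: "null_sets M \<subseteq> sets (Ft 0)"
    and filtration_right_continuous:
      "\<And>t. 0 \<le> t \<Longrightarrow> t < T \<Longrightarrow> sets (Ft t) = (\<Inter>s\<in>{t<..T}. sets (Ft s))"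

definition predictable_sigma :: "'w measure \<Rightarrow> real \<Rightarrow> (real \<Rightarrow> 'w measure) \<Rightarrow> (real \<times> 'w) measure"
  where "predictable_sigma M T Ft = sigma ({0..T} \<times> space M)
    ({{0} \<times> A | A. A \<in> sets (Ft 0)} \<union>
     {{s<..t} \<times> A | s t A. 0 \<le> s \<and> s < t \<and> t \<le> T \<and> A \<in> sets (Ft s)})"

definition predictable :: "'w measure \<Rightarrow> real \<Rightarrow> (real \<Rightarrow> 'w measure) \<Rightarrow> (real \<Rightarrow> 'w \<Rightarrow> real) \<Rightarrow> bool"
  where "predictable M T Ft u \<longleftrightarrow> case_prod u \<in> borel_measurable (predictable_sigma M T Ft)"

definition jointly_measurable :: "'w measure \<Rightarrow> real \<Rightarrow> (real \<Rightarrow> 'w \<Rightarrow> real) \<Rightarrow> bool"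
  where "jointly_measurable M T u \<longleftrightarrow>
    case_prod u \<in> borel_measurable (restrict_space borel {0..T} \<Otimes>\<^sub>M M)"


section \<open>Energy spaces\<close>

text \<open>
  The energy space is the type \<open>'h\<close>, a separable Hilbert space (for a metrizable
  space, second countable means separable).  Its elements are classes of processes: \<open>V\<close> is the
  set of all processes that represent some element, and \<open>cls\<close> is the linear map sending a
  process to its class.  Which processes are identified is left open, except that the values
  outside the time interval are irrelevant.  An element of \<open>'h\<close> is predictable if it has a
  predictable representative.
\<close>

definition predictable_elements ::
  "'w measure \<Rightarrow> real \<Rightarrow> (real \<Rightarrow> 'w measure) \<Rightarrow> (real \<Rightarrow> 'w \<Rightarrow> real) set
    \<Rightarrow> ((real \<Rightarrow> 'w \<Rightarrow> real) \<Rightarrow> 'h) \<Rightarrow> 'h set"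
  where "predictable_elements M T Ft V cls = cls ` {u \<in> V. predictable M T Ft u}"

locale energy_space = usual_filtered_prob_space M T Ft
  for M :: "'w measure" and T :: real and Ft :: "real \<Rightarrow> 'w measure" +
  fixes X :: "real \<Rightarrow> 'w \<Rightarrow> real"
    and V :: "(real \<Rightarrow> 'w \<Rightarrow> real) set"
    and cls :: "(real \<Rightarrow> 'w \<Rightarrow> real) \<Rightarrow> 'h::{real_inner, polish_space}"
    and \<delta> :: "'h \<Rightarrow> 'w \<Rightarrow> real"
  assumes X_square_integrable: "\<And>t. t \<in> {0..T} \<Longrightarrow> X t \<in> L2 M"
    and processes_measurable: "\<And>u. u \<in> V \<Longrightarrow> jointly_measurable M T u"
    and processes_cong:
      "\<And>u v. u \<in> V \<Longrightarrow> (\<And>t w. t \<in> {0..T} \<Longrightarrow> w \<in> space M \<Longrightarrow> v t w = u t w) \<Longrightarrow>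
        v \<in> V \<and> cls v = cls u"
    and processes_linear:
      "\<And>u v a b. u \<in> V \<Longrightarrow> v \<in> V \<Longrightarrow> (\<lambda>t w. a * u t w + b * v t w) \<in> V \<and>
        cls (\<lambda>t w. a * u t w + b * v t w) = a *\<^sub>R cls u + b *\<^sub>R cls v"
    and classes_onto: "cls ` V = UNIV"
    and integral_L2: "\<And>h. \<delta> h \<in> L2 M"
    and integral_linear:
      "\<And>g h a b. AE w in M. \<delta> (a *\<^sub>R g + b *\<^sub>R h) w = a * \<delta> g w + b * \<delta> h w"
    and integral_bounded: "\<exists>C. \<forall>h. L2_norm M (\<delta> h) \<le> C * norm h"
    and predictable_subspace: "subspace (predictable_elements M T Ft V cls)"
    and predictable_closed: "closed (predictable_elements M T Ft V cls)"

definition predictable_projection ::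
  "'w measure \<Rightarrow> real \<Rightarrow> (real \<Rightarrow> 'w measure) \<Rightarrow> (real \<Rightarrow> 'w \<Rightarrow> real) set
    \<Rightarrow> ((real \<Rightarrow> 'w \<Rightarrow> real) \<Rightarrow> 'h) \<Rightarrow> 'h \<Rightarrow> 'h::real_inner"
  where "predictable_projection M T Ft V cls = orth_proj (predictable_elements M T Ft V cls)"

definition covariant_derivative ::
  "'w measure \<Rightarrow> ('h::real_inner \<Rightarrow> 'w \<Rightarrow> real) \<Rightarrow> ('w \<Rightarrow> real) \<Rightarrow> 'h"
  where "covariant_derivative M \<delta> F = (THE g. \<forall>u. L2_inner M F (\<delta> u) = g \<bullet> u)"

end

theory Submission
  imports Defs
begin

text \<open>
  Write \<open>P\<close> for the closed subspace of predictable elements and \<open>p\<close> for the projection of the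
  covariant derivative of \<open>F\<close> onto it.  The claim says that \<open>\<delta> p\<close> is the best approximation of the
  centred variable by elements of the closure of \<open>\<delta> ` P\<close>.  Since \<open>\<delta> p\<close> lies in \<open>\<delta> ` P\<close> already, it
  suffices that \<open>F - E F - \<delta> p\<close> is orthogonal to \<open>\<delta> z\<close> for every \<open>z \<in> P\<close>; Cauchy--Schwarz carries
  the orthogonality over to the closure.  For such \<open>z\<close>, the constant \<open>E F\<close> contributes nothing
  because \<open>\<delta> z\<close> has mean zero, and
  \<open>E[F \<cdot> \<delta> z] = \<langle>D F, z\<rangle> = \<langle>p, z\<rangle> = E[\<delta> p \<cdot> \<delta> z]\<close>:
  the first equality is the adjoint relation, the second the defining property of the projection,
  and the third the polarised isometry on \<open>P\<close>.

  The derivative and the projection are given by definite descriptions, so their existence has to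
  be established by completeness.  Both are Riesz representatives: the derivative represents
  \<open>u \<mapsto> E[F \<cdot> \<delta> u]\<close> on the whole energy space, and the projection of \<open>x\<close> represents \<open>z \<mapsto> \<langle>x, z\<rangle>\<close>
  on \<open>P\<close>.  Thus Riesz' theorem for bounded functionals on a closed subspace serves for both.  In
  \<open>L\<^sup>2(M)\<close> the projection is chosen by \<open>SOME\<close>: \<open>\<delta> p\<close> is a candidate by the orthogonality above,
  and any two candidates agree almost everywhere.
\<close>

section \<open>Riesz representation and orthogonal projection\<close>

text \<open>
  The representative is the minimiser of the energy \<open>J x = \<parallel>x\<parallel>\<^sup>2 - 2 * f x\<close> on \<open>S\<close>.  By the
  parallelogram law minimising sequences of \<open>J\<close> are Cauchy, and the first variation of \<open>J\<close> at the
  minimum \<open>y\<close> in the direction \<open>z\<close> is \<open>2 * (y \<bullet> z - f z)\<close>.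
\<close>

lemma Riesz_representation_closed_subspace:
  fixes S :: "'h::{real_inner, complete_space} set" and f :: "'h \<Rightarrow> real"
  assumes S: "subspace S" "closed S"
    and lin: "\<And>x y a b. x \<in> S \<Longrightarrow> y \<in> S \<Longrightarrow> f (a *\<^sub>R x + b *\<^sub>R y) = a * f x + b * f y"
    and bdd: "\<And>x. x \<in> S \<Longrightarrow> \<bar>f x\<bar> \<le> K * norm x"
  shows "\<exists>y\<in>S. \<forall>z\<in>S. f z = y \<bullet> z"
proof -
  define J where "J x = (norm x)\<^sup>2 - 2 * f x" for x
  have comb: "a *\<^sub>R x + b *\<^sub>R y \<in> S" if "x \<in> S" "y \<in> S" for a b x y
    using S(1) that by (simp add: subspace_add subspace_scale)
  have J_comb: "J (a *\<^sub>R x + b *\<^sub>R y) =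
      a\<^sup>2 * (norm x)\<^sup>2 + 2 * a * b * (x \<bullet> y) + b\<^sup>2 * (norm y)\<^sup>2 - 2 * a * f x - 2 * b * f y"
    if "x \<in> S" "y \<in> S" for a b x y
    unfolding J_def lin[OF that] power2_norm_eq_inner
    by (simp add: inner_add_left inner_add_right inner_commute power2_eq_square algebra_simps)
  have J_lower: "- K\<^sup>2 \<le> J x" if "x \<in> S" for x
  proof -
    have "0 \<le> (norm x - K)\<^sup>2" by simp
    then show ?thesis
      using bdd[OF that] unfolding J_def by (simp add: power2_diff algebra_simps)
  qed
  \<comment> \<open>The infimum is finite: \<open>J\<close> is at least the square of \<open>norm x - K\<close> minus \<open>K\<^sup>2\<close>.\<close>
  define m where "m = Inf (J ` S)"
  have bb: "bdd_below (J ` S)" by (rule bdd_belowI2[OF J_lower])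
  have ne: "J ` S \<noteq> {}" using subspace_0[OF S(1)] by blast
  have m_le: "m \<le> J x" if "x \<in> S" for x
    unfolding m_def using that by (intro cINF_lower bb)
  have "\<exists>x\<in>S. J x < m + 1 / Suc n" for n
    using cInf_lessD[OF ne, of "m + 1 / Suc n"] unfolding m_def by auto
  then obtain x where x: "\<And>n. x n \<in> S" "\<And>n. J (x n) < m + 1 / Suc n" by metis
  \<comment> \<open>Parallelogram law: the linear part of \<open>J\<close> cancels, and the midpoint has energy at least \<open>m\<close>.\<close>
  have dist_x: "(dist (x i) (x j))\<^sup>2 \<le> 2 / Suc i + 2 / Suc j" for i j
  proof -
    have "(dist (x i) (x j))\<^sup>2 = 2 * J (x i) + 2 * J (x j) - 4 * J ((1/2) *\<^sub>R x i + (1/2) *\<^sub>R x j)"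
      unfolding J_comb[OF x(1) x(1)] unfolding J_def dist_norm power2_norm_eq_inner
      by (simp add: inner_diff_left inner_diff_right inner_commute power2_eq_square algebra_simps)
    then show ?thesis
      using x(2)[of i] x(2)[of j] m_le[OF comb[OF x(1) x(1), of "1/2" i "1/2" j]] by simp
  qed
  have "Cauchy x"
  proof (rule metric_CauchyI)
    fix e :: real assume "0 < e"
    then obtain N where N: "1 / Suc N < e\<^sup>2 / 4"
      using nat_approx_posE[of "e\<^sup>2 / 4"] by auto
    have "dist (x i) (x j) < e" if "i \<ge> N" "j \<ge> N" for i j
    proof -
      have "1 / Suc i \<le> 1 / Suc N" "1 / Suc j \<le> 1 / Suc N"
        using that by (simp_all add: frac_le)
      moreover have "2 / Suc i = 2 * (1 / Suc i)" "2 / Suc j = 2 * (1 / Suc j)" by simp_all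
      ultimately have "(dist (x i) (x j))\<^sup>2 < e\<^sup>2"
        using dist_x[of i j] N by linarith
      then show ?thesis using \<open>0 < e\<close> by (simp add: power_less_imp_less_base)
    qed
    then show "\<exists>N. \<forall>i\<ge>N. \<forall>j\<ge>N. dist (x i) (x j) < e" by blast
  qed
  then obtain y where lim: "x \<longlonglongrightarrow> y" using Cauchy_convergent convergent_def by blast
  then have y: "y \<in> S" using S(2) x(1) closed_sequentially by blast
  have "(\<lambda>n. f (x n)) \<longlonglongrightarrow> f y"
  proof (rule metric_tendsto_imp_tendsto)
    show "(\<lambda>n. \<bar>K\<bar> *\<^sub>R (x n - y)) \<longlonglongrightarrow> 0"
      using tendsto_scaleR[OF tendsto_const[of "\<bar>K\<bar>"] tendsto_diff[OF lim tendsto_const[of y]]] by simp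
    have "dist (f (x n)) (f y) \<le> dist (\<bar>K\<bar> *\<^sub>R (x n - y)) 0" for n
    proof -
      have "dist (f (x n)) (f y) = \<bar>f (x n - y)\<bar>"
        using lin[OF x(1) y, of 1 n "-1"] by (simp add: dist_real_def)
      also have "\<dots> \<le> K * norm (x n - y)"
        by (intro bdd subspace_diff S x y)
      also have "\<dots> \<le> \<bar>K\<bar> * norm (x n - y)" by (intro mult_right_mono) auto
      finally show ?thesis by simp
    qed
    then show "\<forall>\<^sub>F n in sequentially. dist (f (x n)) (f y) \<le> dist (\<bar>K\<bar> *\<^sub>R (x n - y)) 0" by simp
  qed
  then have "(\<lambda>n. J (x n)) \<longlonglongrightarrow> J y"
    unfolding J_def by (intro tendsto_intros lim)
  moreover have "(\<lambda>n. m + 1 / Suc n) \<longlonglongrightarrow> m + 0"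
    by (intro tendsto_intros LIMSEQ_Suc lim_1_over_n)
  ultimately have J_y: "J y \<le> m"
    using x(2) by (intro LIMSEQ_le[where X="\<lambda>n. J (x n)" and x="J y"]) (auto intro: less_imp_le)
  have "f z = y \<bullet> z" if z: "z \<in> S" for z
  proof (cases "z = 0")
    case True
    then show ?thesis using bdd[OF z] by simp
  next
    case False
    define d where "d = y \<bullet> z - f z"
    \<comment> \<open>The step that minimises the quadratic \<open>t \<mapsto> J (y + t *\<^sub>R z)\<close>.\<close>
    define t where "t = - d / (norm z)\<^sup>2"
    have "J y \<le> J (1 *\<^sub>R y + t *\<^sub>R z)" using J_y m_le[OF comb[OF y z]] by (rule order_trans)
    also have "\<dots> = J y + 2 * t * d + t\<^sup>2 * (norm z)\<^sup>2"
      unfolding J_comb[OF y z] by (simp add: J_def d_def algebra_simps)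
    also have "\<dots> = J y - d\<^sup>2 / (norm z)\<^sup>2"
      using False by (simp add: t_def field_simps power2_eq_square)
    finally have "d\<^sup>2 / (norm z)\<^sup>2 \<le> 0" by simp
    then have "d = 0" using False by (simp add: divide_le_0_iff)
    then show ?thesis by (simp add: d_def)
  qed
  then show ?thesis using y by blast
qed

text \<open>
  The projection of \<open>x\<close> onto \<open>S\<close> is the element of \<open>S\<close> that represents the restriction to \<open>S\<close> of
  the functional \<open>z \<mapsto> x \<bullet> z\<close>.
\<close>

lemma orth_proj:
  fixes S :: "'h::{real_inner, complete_space} set"
  assumes S: "subspace S" "closed S"
  shows orth_proj_in: "orth_proj S x \<in> S"
    and orth_proj_inner: "z \<in> S \<Longrightarrow> orth_proj S x \<bullet> z = x \<bullet> z"
proof -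
  obtain y where y: "y \<in> S" "\<And>z. z \<in> S \<Longrightarrow> x \<bullet> z = y \<bullet> z"
    using Riesz_representation_closed_subspace[OF S, of "\<lambda>z. x \<bullet> z" "norm x"]
    by (auto simp: inner_add_right Cauchy_Schwarz_ineq2)
  have "orth_proj S x = y"
    unfolding orth_proj_def
  proof (rule the_equality)
    show "y \<in> S \<and> (\<forall>z\<in>S. orthogonal (x - y) z)"
      using y by (simp add: orthogonal_def inner_diff_left)
    fix y' assume y': "y' \<in> S \<and> (\<forall>z\<in>S. orthogonal (x - y') z)"
    then have "(y' - y) \<bullet> z = 0" if "z \<in> S" for z
      using y(2)[OF that] that by (simp add: orthogonal_def inner_diff_left)
    then have "(y' - y) \<bullet> (y' - y) = 0" using y' y(1) S(1) subspace_diff by blast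
    then show "y' = y" by simp
  qed
  then show "orth_proj S x \<in> S" "z \<in> S \<Longrightarrow> orth_proj S x \<bullet> z = x \<bullet> z"
    using y by simp_all
qed

section \<open>Geometry of square-integrable random variables\<close>

lemma L2_integrable_mult:
  assumes "f \<in> L2 M" "g \<in> L2 M"
  shows "integrable M (\<lambda>w. f w * g w)"
proof (rule Bochner_Integration.integrable_bound)
  show "integrable M (\<lambda>w. (f w)\<^sup>2 + (g w)\<^sup>2)" "(\<lambda>w. f w * g w) \<in> borel_measurable M"
    using assms by (auto simp: L2_def)
  have "\<bar>a * b\<bar> \<le> a\<^sup>2 + b\<^sup>2" for a b :: real
  proof -
    have "0 \<le> \<bar>a\<bar> * \<bar>b\<bar>" by simp
    then show ?thesis
      using sum_squares_bound[of "\<bar>a\<bar>" "\<bar>b\<bar>"] unfolding abs_mult power2_abs by linarith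
  qed
  then show "AE w in M. norm (f w * g w) \<le> norm ((f w)\<^sup>2 + (g w)\<^sup>2)" by simp
qed

lemma L2_combination:
  assumes "f \<in> L2 M" "g \<in> L2 M"
  shows "(\<lambda>w. a * f w + b * g w) \<in> L2 M"
proof -
  have "(\<lambda>w. (a * f w + b * g w)\<^sup>2) = (\<lambda>w. a\<^sup>2 * (f w)\<^sup>2 + 2 * a * b * (f w * g w) + b\<^sup>2 * (g w)\<^sup>2)"
    by (auto simp: power2_eq_square algebra_simps)
  then show ?thesis
    using assms L2_integrable_mult[OF assms] by (auto simp: L2_def)
qed

lemma L2_diff:
  assumes "f \<in> L2 M" "g \<in> L2 M"
  shows "(\<lambda>w. f w - g w) \<in> L2 M"
  using L2_combination[OF assms, of 1 "-1"] by simp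

lemma L2_inner_commute: "L2_inner M f g = L2_inner M g f"
  by (simp add: L2_inner_def mult.commute)

lemma L2_inner_combination:
  assumes "f \<in> L2 M" "g \<in> L2 M" "h \<in> L2 M"
  shows "L2_inner M (\<lambda>w. a * f w + b * g w) h = a * L2_inner M f h + b * L2_inner M g h"
  using L2_integrable_mult[OF assms(1,3)] L2_integrable_mult[OF assms(2,3)]
  by (simp add: L2_inner_def distrib_right mult.assoc)

lemma L2_inner_diff:
  assumes "f \<in> L2 M" "g \<in> L2 M" "h \<in> L2 M"
  shows "L2_inner M (\<lambda>w. f w - g w) h = L2_inner M f h - L2_inner M g h"
  using L2_inner_combination[OF assms, of 1 "-1"] by simp

lemma L2_inner_combination_right:
  assumes "f \<in> L2 M" "g \<in> L2 M" "h \<in> L2 M"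
  shows "L2_inner M h (\<lambda>w. a * f w + b * g w) = a * L2_inner M h f + b * L2_inner M h g"
  using L2_inner_combination[OF assms] by (simp only: L2_inner_commute[of M h])

lemma L2_inner_diff_right:
  assumes "f \<in> L2 M" "g \<in> L2 M" "h \<in> L2 M"
  shows "L2_inner M h (\<lambda>w. f w - g w) = L2_inner M h f - L2_inner M h g"
  using L2_inner_combination_right[OF assms, of 1 "-1"] by simp

lemma L2_norm_power2: "(L2_norm M f)\<^sup>2 = L2_inner M f f"
  by (simp add: L2_norm_def L2_inner_def)

lemma L2_norm_nonneg: "0 \<le> L2_norm M f"
  by (simp add: L2_norm_def L2_inner_def)

lemma L2_norm_eq_0_iff:
  assumes "f \<in> L2 M"
  shows "L2_norm M f = 0 \<longleftrightarrow> (AE w in M. f w = 0)"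
  using assms integral_nonneg_eq_0_iff_AE[of M "\<lambda>w. (f w)\<^sup>2"]
  by (simp add: L2_norm_def L2_inner_def L2_def power2_eq_square)

text \<open>
  Expanding the square norm of \<open>\<langle>g, g\<rangle> f - \<langle>f, g\<rangle> g\<close>, which is \<open>\<langle>g, g\<rangle>\<close> times the discriminant.
\<close>

lemma L2_Cauchy_Schwarz:
  assumes f: "f \<in> L2 M" and g: "g \<in> L2 M"
  shows "\<bar>L2_inner M f g\<bar> \<le> L2_norm M f * L2_norm M g"
proof (cases "L2_norm M g = 0")
  case True
  then have "AE w in M. f w * g w = 0" using L2_norm_eq_0_iff[OF g] by auto
  then have "L2_inner M f g = 0" unfolding L2_inner_def by (rule integral_eq_zero_AE)
  then show ?thesis using True by simp
next
  case False
  define a b c where "a = L2_inner M f f" and "b = L2_inner M f g" and "c = L2_inner M g g"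
  have c: "c > 0"
    using False L2_norm_power2[of M g] unfolding c_def by (metis zero_less_power2)
  define k where "k = (\<lambda>w. c * f w + (- b) * g w)"
  have k: "k \<in> L2 M" unfolding k_def by (rule L2_combination[OF f g])
  have "0 \<le> L2_inner M k k" by (simp add: L2_inner_def)
  also have "L2_inner M k k = c * L2_inner M k f + (- b) * L2_inner M k g"
    using L2_inner_combination_right[OF f g k, of c "- b"] by (simp only: k_def[symmetric])
  also have "\<dots> = c * (a * c - b\<^sup>2)"
    unfolding k_def L2_inner_combination[OF f g f] L2_inner_combination[OF f g g]
    by (simp add: a_def b_def c_def L2_inner_commute[of M g f] power2_eq_square algebra_simps)
  finally have "b\<^sup>2 \<le> a * c" using c by (simp add: zero_le_mult_iff)
  then have "\<bar>b\<bar>\<^sup>2 \<le> (L2_norm M f * L2_norm M g)\<^sup>2"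
    by (simp add: a_def c_def power_mult_distrib L2_norm_power2)
  then show ?thesis
    unfolding b_def by (rule power2_le_imp_le) (simp add: L2_norm_nonneg)
qed

lemma L2_inner_cong_AE:
  assumes "f \<in> L2 M" "f' \<in> L2 M" "g \<in> L2 M" "AE w in M. f w = f' w"
  shows "L2_inner M f g = L2_inner M f' g"
  unfolding L2_inner_def using assms by (intro integral_cong_AE) (auto simp: L2_def)

lemma L2_orthogonal_closure:
  assumes f: "f \<in> L2 M" and S: "S \<subseteq> L2 M" and h: "h \<in> L2_closure M S"
    and orth: "\<And>g. g \<in> S \<Longrightarrow> L2_inner M f g = 0"
  shows "L2_inner M f h = 0"
proof (rule ccontr)
  assume nz: "L2_inner M f h \<noteq> 0"
  \<comment> \<open>Adding 1 to the norm makes the bound strict and covers \<open>f = 0\<close>.\<close>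
  define e where "e = \<bar>L2_inner M f h\<bar> / (L2_norm M f + 1)"
  have pos: "0 < L2_norm M f + 1" using L2_norm_nonneg[of M f] by simp
  then have "0 < e" using nz by (simp add: e_def)
  then obtain g where g: "g \<in> S" "L2_norm M (\<lambda>w. h w - g w) < e" and hL: "h \<in> L2 M"
    using h by (auto simp: L2_closure_def)
  have gL: "g \<in> L2 M" using g S by blast
  have "L2_inner M f h = L2_inner M f (\<lambda>w. h w - g w)"
    using L2_inner_diff_right[OF hL gL f] orth[OF g(1)] by simp
  then have "\<bar>L2_inner M f h\<bar> \<le> L2_norm M f * L2_norm M (\<lambda>w. h w - g w)"
    using L2_Cauchy_Schwarz[OF f L2_diff[OF hL gL]] by simp
  also have "\<dots> \<le> L2_norm M f * e"
    using g(2) L2_norm_nonneg by (intro mult_left_mono) auto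
  also have "\<dots> < (L2_norm M f + 1) * e" using \<open>0 < e\<close> by (simp add: distrib_right)
  also have "\<dots> = \<bar>L2_inner M f h\<bar>" using pos by (simp add: e_def)
  finally show False by simp
qed

text \<open>
  Exhibiting one projection determines the chosen one: if \<open>g\<close> and \<open>p\<close> are both projections of \<open>f\<close>,
  then \<open>g - p\<close> is orthogonal to \<open>S\<close>, in particular to \<open>g\<close> and to \<open>p\<close>, hence to itself.
\<close>

lemma L2_proj_eqI:
  assumes f: "f \<in> L2 M" and S: "S \<subseteq> L2 M" and g: "g \<in> S"
    and orth: "\<And>h. h \<in> S \<Longrightarrow> L2_inner M (\<lambda>w. f w - g w) h = 0"
  shows "AE w in M. g w = L2_proj M S f w"
proof -
  define p where "p = L2_proj M S f"
  have p: "p \<in> S \<and> (\<forall>h\<in>S. L2_inner M (\<lambda>w. f w - p w) h = 0)"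
    unfolding p_def L2_proj_def by (rule someI[of _ g]) (simp add: g orth)
  have L: "g \<in> L2 M" "p \<in> L2 M" using g p S by auto
  let ?d = "\<lambda>w. g w - p w"
  have d: "?d \<in> L2 M" by (rule L2_diff[OF L])
  have 0: "L2_inner M ?d h = 0" if "h \<in> S" for h
    using orth[OF that] p that S
    by (auto simp: L2_inner_diff L subset_iff f)
  have "L2_inner M ?d ?d = 0"
    using L2_inner_diff_right[OF L d] 0[OF g] 0[of p] p by simp
  then have "L2_norm M ?d = 0" by (simp add: L2_norm_def)
  then show ?thesis using L2_norm_eq_0_iff[OF d] by (simp add: p_def)
qed

section \<open>The stochastic integral and its adjoint\<close>

context energy_space
begin

lemma L2_inner_integral_combination:
  assumes "F \<in> L2 M"
  shows "L2_inner M F (\<delta> (a *\<^sub>R g + b *\<^sub>R h)) = a * L2_inner M F (\<delta> g) + b * L2_inner M F (\<delta> h)"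
proof -
  have "L2_inner M (\<delta> (a *\<^sub>R g + b *\<^sub>R h)) F = L2_inner M (\<lambda>w. a * \<delta> g w + b * \<delta> h w) F"
    by (intro L2_inner_cong_AE integral_L2 L2_combination integral_linear assms)
  then show ?thesis
    by (simp only: L2_inner_commute[of M F] L2_inner_combination[OF integral_L2 integral_L2 assms])
qed

text \<open>
  Boundedness of the stochastic integral makes \<open>u \<mapsto> E[F \<cdot> \<delta> u]\<close> a bounded functional, so the
  description that defines the derivative denotes its Riesz representative.
\<close>

lemma covariant_derivative_adjoint:
  assumes F: "F \<in> L2 M"
  shows "covariant_derivative M \<delta> F \<bullet> u = L2_inner M F (\<delta> u)"
proof -
  obtain C where C: "\<And>h. L2_norm M (\<delta> h) \<le> C * norm h" using integral_bounded by blast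
  have bdd: "\<bar>L2_inner M F (\<delta> h)\<bar> \<le> (L2_norm M F * C) * norm h" for h
    using order_trans[OF L2_Cauchy_Schwarz[OF F integral_L2]
        mult_left_mono[OF C L2_norm_nonneg]] by (simp add: mult.assoc)
  obtain g where g: "\<And>u. L2_inner M F (\<delta> u) = g \<bullet> u"
    using Riesz_representation_closed_subspace[OF subspace_UNIV closed_UNIV,
        of "\<lambda>u. L2_inner M F (\<delta> u)", OF L2_inner_integral_combination[OF F] bdd] by blast
  have "covariant_derivative M \<delta> F = g"
    unfolding covariant_derivative_def
  proof (rule the_equality)
    fix g' assume "\<forall>u. L2_inner M F (\<delta> u) = g' \<bullet> u"
    then have "(g' - g) \<bullet> (g' - g) = 0" using g by (simp add: inner_diff_left)
    then show "g' = g" by simp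
  qed (use g in blast)
  then show ?thesis using g by simp
qed

text \<open>Polarisation: the square norms of \<open>u\<close>, \<open>v\<close> and \<open>u + v\<close> determine \<open>u \<bullet> v\<close>.\<close>

lemma isometry_imp_inner_eq:
  assumes S: "subspace S"
    and iso: "\<And>u. u \<in> S \<Longrightarrow> (LINT w|M. \<bar>\<delta> u w\<bar>\<^sup>2) = (norm u)\<^sup>2"
    and "u \<in> S" "v \<in> S"
  shows "L2_inner M (\<delta> u) (\<delta> v) = u \<bullet> v"
proof -
  have sq: "L2_inner M (\<delta> u) (\<delta> u) = u \<bullet> u" if "u \<in> S" for u
    using iso[OF that] unfolding power2_norm_eq_inner power2_abs
    by (simp add: L2_inner_def power2_eq_square)
  have "u + v \<in> S" using assms by (simp add: subspace_add)
  have add: "L2_inner M G (\<delta> (u + v)) = L2_inner M G (\<delta> u) + L2_inner M G (\<delta> v)" if "G \<in> L2 M" for G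
    using L2_inner_integral_combination[OF that, of 1 u 1 v] by simp
  have "(u + v) \<bullet> (u + v) = L2_inner M (\<delta> (u + v)) (\<delta> u) + L2_inner M (\<delta> (u + v)) (\<delta> v)"
    using sq[OF \<open>u + v \<in> S\<close>] add[OF integral_L2] by simp
  also have "\<dots> = u \<bullet> u + 2 * L2_inner M (\<delta> u) (\<delta> v) + v \<bullet> v"
    unfolding L2_inner_commute[of M "\<delta> (u + v)"] add[OF integral_L2]
    using sq assms(3,4) L2_inner_commute[of M "\<delta> v" "\<delta> u"] by simp
  finally show ?thesis by (simp add: inner_add_left inner_add_right inner_commute)
qed

end

section \<open>Projection of the derivative and projection of the random variable\<close>

theorem proposition6p3:
  fixes M :: "'w measure" and T :: real and Ft :: "real \<Rightarrow> 'w measure"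
    and X :: "real \<Rightarrow> 'w \<Rightarrow> real"
    and V :: "(real \<Rightarrow> 'w \<Rightarrow> real) set"
    and cls :: "(real \<Rightarrow> 'w \<Rightarrow> real) \<Rightarrow> 'h::{real_inner, polish_space}"
    and \<delta> :: "'h \<Rightarrow> 'w \<Rightarrow> real"
    and F :: "'w \<Rightarrow> real"
  assumes "energy_space M T Ft X V cls \<delta>"
    and "\<And>u. prob_space.expectation M (\<delta> u) = 0"
    and "\<And>u. u \<in> predictable_elements M T Ft V cls \<Longrightarrow>
      prob_space.expectation M (\<lambda>w. \<bar>\<delta> u w\<bar>\<^sup>2) = (norm u)\<^sup>2"
    and "F \<in> L2 M"
  shows "AE w in M.
    \<delta> (predictable_projection M T Ft V cls (covariant_derivative M \<delta> F)) w =
    L2_proj M (L2_closure M (\<delta> ` predictable_elements M T Ft V cls))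
      (\<lambda>w. F w - prob_space.expectation M F) w"
proof -
  interpret energy_space M T Ft X V cls \<delta> by fact
  define P where "P = predictable_elements M T Ft V cls"
  have P: "subspace P" "closed P"
    unfolding P_def by (rule predictable_subspace predictable_closed)+
  define p where "p = predictable_projection M T Ft V cls (covariant_derivative M \<delta> F)"
  have p: "p \<in> P" "\<And>z. z \<in> P \<Longrightarrow> p \<bullet> z = covariant_derivative M \<delta> F \<bullet> z"
    unfolding p_def predictable_projection_def P_def[symmetric]
    using orth_proj_in[OF P] orth_proj_inner[OF P] by auto
  have const: "(\<lambda>_. c) \<in> L2 M" for c by (simp add: L2_def)
  define G where "G = (\<lambda>w. F w - expectation F)"
  have G: "G \<in> L2 M" unfolding G_def by (rule L2_diff[OF \<open>F \<in> L2 M\<close> const])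
  have D: "(\<lambda>w. G w - \<delta> p w) \<in> L2 M" by (rule L2_diff[OF G integral_L2])
  have sub: "\<delta> ` P \<subseteq> L2 M" using integral_L2 by auto
  have orth: "L2_inner M (\<lambda>w. G w - \<delta> p w) (\<delta> z) = 0" if z: "z \<in> P" for z
  proof -
    have "L2_inner M G (\<delta> z) = L2_inner M F (\<delta> z)"
      unfolding G_def L2_inner_diff[OF \<open>F \<in> L2 M\<close> const integral_L2]
      using assms(2)[of z] by (simp add: L2_inner_def)
    also have "\<dots> = p \<bullet> z"
      using covariant_derivative_adjoint[OF \<open>F \<in> L2 M\<close>] p(2)[OF z] by simp
    also have "\<dots> = L2_inner M (\<delta> p) (\<delta> z)"
      using isometry_imp_inner_eq[OF P(1) _ p(1) z] assms(3) by (simp add: P_def)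
    finally show ?thesis using L2_inner_diff[OF G integral_L2 integral_L2] by simp
  qed
  have "L2_norm M (\<lambda>w. \<delta> p w - \<delta> p w) = 0" by (simp add: L2_norm_def L2_inner_def)
  then have "\<delta> p \<in> L2_closure M (\<delta> ` P)"
    using p(1) integral_L2 unfolding L2_closure_def by force
  moreover have "L2_inner M (\<lambda>w. G w - \<delta> p w) h = 0" if "h \<in> L2_closure M (\<delta> ` P)" for h
    using L2_orthogonal_closure[OF D sub that] orth by blast
  moreover have "L2_closure M (\<delta> ` P) \<subseteq> L2 M" by (auto simp: L2_closure_def)
  ultimately have "AE w in M. \<delta> p w = L2_proj M (L2_closure M (\<delta> ` P)) G w"
    by (intro L2_proj_eqI G)
  then show ?thesis by (simp add: p_def P_def G_def)
qed

end
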